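(* Let $A,B\in\mathbb{C}^{m\times n}$ with $\operatorname{rank}(A)=r\ge 1$ and $\operatorname{rank}(B)=s\ge 1$, and let $E=B-A$ and $\widetilde{E}=B^{\dagger}-A^{\dagger}$. Define \[ \alpha'_{1}:=\min\big\{\|B\|_{2}^{2}\|B^{\dagger}EA^{\dagger}\|_{F}^{2},\ \|A^{\dagger}\|_{2}^{2}\|B\widetilde{E}A\|_{F}^{2}\big\},\qquad \alpha'_{2}:=\min\big\{\|A\|_{2}^{2}\|A^{\dagger}EB^{\dagger}\|_{F}^{2},\ \|B^{\dagger}\|_{2}^{2}\|A\widetilde{E}B\|_{F}^{2}\big\}. \] Then \[ \|P_{B}-P_{A}\|_{F}^{2}\geq\|EA^{\dagger}\|_{F}^{2}+\|EB^{\dagger}\|_{F}^{2}-\alpha'_{1}-\alpha'_{2}. \] In particular, if $s=r$, then \[ \|P_{B}-P_{A}\|_{F}^{2}\geq 2\max\big\{\|EA^{\dagger}\|_{F}^{2}-\alpha'_{1},\ \|EB^{\dagger}\|_{F}^{2}-\alpha'_{2}\big\}. \]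
   Context: For a complex matrix $M$: $M^{\dagger}$ is the Moore--Penrose inverse, $\|M\|_{F}$ the Frobenius norm, $\|M\|_{2}$ the spectral norm, and $P_{M}=MM^{\dagger}$ the orthogonal projection onto the column space of $M$. *)

theory Defs
  imports "HOL-Analysis.Analysis"
begin

definition ctranspose :: "complex^'n^'m \<Rightarrow> complex^'m^'n" where
  "ctranspose M = map_matrix cnj (transpose M)"

text \<open>The Moore--Penrose inverse is the unique solution of the four Penrose equations
  (existence and uniqueness are shown in \<open>ex1_moore_penrose\<close> below).\<close>

definition is_moore_penrose :: "complex^'n^'m \<Rightarrow> complex^'m^'n \<Rightarrow> bool" where
  "is_moore_penrose M X \<longleftrightarrow>
     M ** X ** M = M \<and> X ** M ** X = X \<and>
     ctranspose (M ** X) = M ** X \<and> ctranspose (X ** M) = X ** M"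

definition pinv :: "complex^'n^'m \<Rightarrow> complex^'m^'n" where
  "pinv M = (THE X. is_moore_penrose M X)"

definition col_proj :: "complex^'n^'m \<Rightarrow> complex^'m^'m" where
  "col_proj M = M ** pinv M"

definition frob_norm :: "complex^'n^'m \<Rightarrow> real" where
  "frob_norm M = sqrt (\<Sum>i\<in>UNIV. \<Sum>j\<in>UNIV. (cmod (M $ i $ j))\<^sup>2)"

text \<open>The norm of the library on \<open>complex^'n\<close> is the Euclidean one, so this is the operator norm
  induced by the Euclidean norms.\<close>

definition spec_norm :: "complex^'n^'m \<Rightarrow> real" where
  "spec_norm M = onorm (\<lambda>x. M *v x)"

definition alpha1 :: "complex^'n^'m \<Rightarrow> complex^'n^'m \<Rightarrow> real" where
  "alpha1 A B =
     min ((spec_norm B)\<^sup>2 * (frob_norm (pinv B ** (B - A) ** pinv A))\<^sup>2)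
         ((spec_norm (pinv A))\<^sup>2 * (frob_norm (B ** (pinv B - pinv A) ** A))\<^sup>2)"

definition alpha2 :: "complex^'n^'m \<Rightarrow> complex^'n^'m \<Rightarrow> real" where
  "alpha2 A B =
     min ((spec_norm A)\<^sup>2 * (frob_norm (pinv A ** (B - A) ** pinv B))\<^sup>2)
         ((spec_norm (pinv B))\<^sup>2 * (frob_norm (A ** (pinv B - pinv A) ** B))\<^sup>2)"

lemma frob_norm_eq_norm: "frob_norm M = norm M"
  by (simp add: frob_norm_def norm_vec_def L2_set_def sum_nonneg)

lemma ctranspose_nth: "ctranspose M $ i $ j = cnj (M $ j $ i)"
  by (simp add: ctranspose_def transpose_def)

lemma ctranspose_ctranspose [simp]: "ctranspose (ctranspose M) = M"
  by (simp add: vec_eq_iff ctranspose_nth)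

lemma ctranspose_mult: "ctranspose (M ** N) = ctranspose N ** ctranspose M"
  by (simp add: vec_eq_iff ctranspose_nth matrix_matrix_mult_def mult.commute)

lemma inner_ctranspose: "(M *v x) \<bullet> y = x \<bullet> (ctranspose M *v y)"
proof -
  have "(M *v x) \<bullet> y = (\<Sum>i\<in>UNIV. \<Sum>j\<in>UNIV. (M $ i $ j * x $ j) \<bullet> (y $ i))"
    by (simp add: inner_vec_def matrix_vector_mult_def inner_sum_left)
  also have "\<dots> = (\<Sum>i\<in>UNIV. \<Sum>j\<in>UNIV. (x $ j) \<bullet> (cnj (M $ i $ j) * y $ i))"
    by (intro sum.cong refl) (simp add: inner_complex_def algebra_simps)
  also have "\<dots> = (\<Sum>j\<in>UNIV. \<Sum>i\<in>UNIV. (x $ j) \<bullet> (cnj (M $ i $ j) * y $ i))"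
    by (rule sum.swap)
  also have "\<dots> = x \<bullet> (ctranspose M *v y)"
    by (simp add: inner_vec_def matrix_vector_mult_def inner_sum_right ctranspose_nth)
  finally show ?thesis .
qed

lemma ctranspose_mult_cancel:
  assumes "ctranspose M ** M ** X = ctranspose M ** M ** Y"
  shows "M ** X = M ** Y"
proof -
  have "M *v (X *v v) = M *v (Y *v v)" for v
  proof -
    let ?d = "X *v v - Y *v v"
    have "ctranspose M *v (M *v ?d) = 0"
      using arg_cong[OF assms, of "\<lambda>N. N *v v"]
      by (simp add: matrix_vector_mult_diff_distrib matrix_vector_mul_assoc matrix_mul_assoc)
    then have "(M *v ?d) \<bullet> (M *v ?d) = 0"
      by (simp add: inner_ctranspose)
    then show ?thesis
      by (simp add: matrix_vector_mult_diff_distrib)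
  qed
  then show ?thesis
    by (simp add: matrix_eq matrix_vector_mul_assoc)
qed

lemma mult_axis: "(M :: complex^'n^'m) *v axis j 1 = column j M"
  by (simp add: vec_eq_iff matrix_vector_mult_def axis_def column_def if_distrib cong: if_cong)

lemma normal_equations:
  fixes M :: "complex^'n^'m"
  obtains Y :: "complex^'m^'n" where "ctranspose M ** M ** Y = ctranspose M"
proof -
  have "\<exists>x. ctranspose M *v (M *v x) = ctranspose M *v y" for y
  proof -
    have sub: "subspace (range ((*v) M))"
      by (intro linear_subspace_image matrix_vector_mul_linear) auto
    obtain p z where p: "p \<in> span (range ((*v) M))"
      and z: "\<And>w. w \<in> span (range ((*v) M)) \<Longrightarrow> orthogonal z w" and y: "y = p + z"
      using orthogonal_subspace_decomp_exists[of "range ((*v) M)" y] by metis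
    obtain x where x: "p = M *v x"
      using p sub by (metis imageE span_eq_iff)
    have "(M *v (ctranspose M *v z)) \<bullet> z = 0"
      using z[of "M *v (ctranspose M *v z)"]
      by (metis inner_commute orthogonal_def rangeI span_base)
    then have "ctranspose M *v z = 0"
      using inner_ctranspose[of M "ctranspose M *v z" z] by simp
    then show ?thesis
      using x y by (auto simp: matrix_vector_right_distrib)
  qed
  then obtain g where g: "\<And>y. ctranspose M *v (M *v g y) = ctranspose M *v y"
    by metis
  define Y :: "complex^'m^'n" where "Y = (\<chi> i j. g (axis j 1) $ i)"
  have "column j (ctranspose M ** M ** Y) = column j (ctranspose M)" for j
  proof -
    have "Y *v axis j 1 = g (axis j 1)"
      by (simp add: mult_axis column_def Y_def vec_eq_iff)
    then have "(ctranspose M ** M ** Y) *v axis j 1 = ctranspose M *v axis j 1"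
      by (metis g matrix_vector_mul_assoc)
    then show ?thesis
      by (simp add: mult_axis)
  qed
  then have "ctranspose M ** M ** Y = ctranspose M"
    by (simp add: column_def vec_eq_iff)
  then show thesis by (rule that)
qed

lemma least_squares_inverse:
  fixes M :: "complex^'n^'m"
  obtains Y :: "complex^'m^'n" where "M ** Y ** M = M" "ctranspose (M ** Y) = M ** Y"
proof -
  obtain Y :: "complex^'m^'n" where Y: "ctranspose M ** M ** Y = ctranspose M"
    by (rule normal_equations)
  have "ctranspose M ** M ** (Y ** M) = ctranspose M ** M ** mat 1"
    using Y by (metis matrix_mul_assoc matrix_mul_rid)
  then have 1: "M ** Y ** M = M"
    by (metis ctranspose_mult_cancel matrix_mul_assoc matrix_mul_rid)
  have "ctranspose (M ** Y) ** (M ** Y) = ctranspose (M ** Y)"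
    using Y by (metis ctranspose_mult matrix_mul_assoc)
  then have "ctranspose (M ** Y) = M ** Y"
    by (metis ctranspose_ctranspose ctranspose_mult)
  with 1 show thesis by (rule that)
qed

lemma moore_penrose_unique:
  assumes X: "is_moore_penrose M X" and Y: "is_moore_penrose M Y"
  shows "X = Y"
proof -
  note x = X[unfolded is_moore_penrose_def] and y = Y[unfolded is_moore_penrose_def]
  have "M ** X = ctranspose (M ** X) ** ctranspose (M ** Y)"
    using x y by (metis ctranspose_mult matrix_mul_assoc)
  then have 1: "M ** X = M ** Y"
    using x y by (metis matrix_mul_assoc ctranspose_mult)
  have "X ** M = ctranspose (Y ** M) ** ctranspose (X ** M)"
    using x y by (metis ctranspose_mult matrix_mul_assoc)
  then have 2: "X ** M = Y ** M"
    using x y by (metis matrix_mul_assoc ctranspose_mult)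
  have "X = X ** (M ** Y)" using x 1 by (metis matrix_mul_assoc)
  also have "\<dots> = Y" using y 2 by (metis matrix_mul_assoc)
  finally show ?thesis .
qed

lemma ex1_moore_penrose:
  fixes M :: "complex^'n^'m"
  shows "\<exists>!X. is_moore_penrose M X"
proof -
  obtain Y :: "complex^'m^'n" where Y: "M ** Y ** M = M" "ctranspose (M ** Y) = M ** Y"
    by (rule least_squares_inverse)
  obtain W where W: "ctranspose M ** W ** ctranspose M = ctranspose M"
      "ctranspose (ctranspose M ** W) = ctranspose M ** W"
    by (rule least_squares_inverse)
  define Z where "Z = ctranspose W"
  have Z: "M ** Z ** M = M" "ctranspose (Z ** M) = Z ** M"
    using W unfolding Z_def
    by (metis ctranspose_ctranspose ctranspose_mult matrix_mul_assoc)+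
  let ?X = "Z ** M ** Y"
  have MX: "M ** ?X = M ** Y" using Z by (metis matrix_mul_assoc)
  have XM: "?X ** M = Z ** M" using Y by (metis matrix_mul_assoc)
  have "?X ** M ** ?X = ?X"
    unfolding XM using Z by (metis matrix_mul_assoc)
  then have "is_moore_penrose M ?X"
    unfolding is_moore_penrose_def MX XM using Y Z by simp
  then show ?thesis
    using moore_penrose_unique by blast
qed

lemma pinv_moore_penrose: "is_moore_penrose M (pinv M)"
  unfolding pinv_def by (rule theI') (rule ex1_moore_penrose)

end

theory Submission
  imports Defs
begin

text \<open>Write \<open>P = P\<^sub>A\<close> and \<open>Q = P\<^sub>B\<close>. Then
  \<open>\<parallel>Q - P\<parallel>\<^sub>F\<^sup>2 = \<parallel>P - QP\<parallel>\<^sub>F\<^sup>2 + \<parallel>Q - PQ\<parallel>\<^sub>F\<^sup>2\<close>. Since \<open>E A\<^sup>\<dagger> = B A\<^sup>\<dagger> - P\<close>, splitting \<open>E A\<^sup>\<dagger>\<close>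
  orthogonally along \<open>Q\<close> gives \<open>\<parallel>E A\<^sup>\<dagger>\<parallel>\<^sub>F\<^sup>2 = \<parallel>P - QP\<parallel>\<^sub>F\<^sup>2 + \<parallel>Q E A\<^sup>\<dagger>\<parallel>\<^sub>F\<^sup>2\<close>, and the last term is at most
  \<open>\<alpha>'\<^sub>1\<close> because \<open>Q E A\<^sup>\<dagger> = B (B\<^sup>\<dagger> E A\<^sup>\<dagger>) = - (B (B\<^sup>\<dagger> - A\<^sup>\<dagger>) A) A\<^sup>\<dagger>\<close>. The other summand is the same with
  \<open>A\<close> and \<open>B\<close> exchanged. For equal ranks the traces of \<open>P\<close> and \<open>Q\<close> agree, so the two summands of
  \<open>\<parallel>Q - P\<parallel>\<^sub>F\<^sup>2\<close> are equal.\<close>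

section \<open>Matrix algebra and norm inequalities\<close>

lemma matrix_diff_ldistrib:
  fixes A :: "'a::comm_ring_1^'n^'m" and B C :: "'a^'p^'n"
  shows "A ** (B - C) = A ** B - A ** C"
  by (simp add: matrix_matrix_mult_def vec_eq_iff right_diff_distrib sum_subtractf)

lemma matrix_diff_rdistrib:
  fixes A B :: "'a::comm_ring_1^'n^'m" and C :: "'a^'p^'n"
  shows "(A - B) ** C = A ** C - B ** C"
  by (simp add: matrix_matrix_mult_def vec_eq_iff left_diff_distrib sum_subtractf)

lemma ctranspose_diff: "ctranspose (M - N) = ctranspose M - ctranspose N"
  by (simp add: vec_eq_iff ctranspose_nth)

lemma frob_norm_ctranspose: "frob_norm (ctranspose M) = frob_norm M"
  unfolding frob_norm_def ctranspose_nth complex_mod_cnj by (subst sum.swap) (rule refl)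

lemma frob_norm_square_trace: "(frob_norm M)\<^sup>2 = Re (trace (ctranspose M ** M))"
proof -
  have "(frob_norm M)\<^sup>2 = (\<Sum>i\<in>UNIV. \<Sum>j\<in>UNIV. (cmod (M $ i $ j))\<^sup>2)"
    by (simp add: frob_norm_def sum_nonneg)
  also have "\<dots> = (\<Sum>j\<in>UNIV. \<Sum>i\<in>UNIV. Re (cnj (M $ i $ j) * M $ i $ j))"
    unfolding cmod_power2 by (subst sum.swap) (simp add: power2_eq_square)
  finally show ?thesis
    by (simp add: trace_def matrix_matrix_mult_def ctranspose_nth)
qed

lemma norm_mult_vec_le: "norm (M *v x) \<le> spec_norm M * norm x"
  unfolding spec_norm_def by (rule onorm) auto

lemma spec_norm_nonneg: "0 \<le> spec_norm M"
  unfolding spec_norm_def by (rule onorm_pos_le) auto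

text \<open>For \<open>?y = ctranspose M *v x\<close>, Cauchy-Schwarz applied to
  \<open>(M *v ?y) \<bullet> x\<close> bounds the square of \<open>norm ?y\<close>; one factor
  \<open>norm ?y\<close> then cancels.\<close>

lemma spec_norm_ctranspose_le: "spec_norm (ctranspose M) \<le> spec_norm M"
proof -
  have "norm (ctranspose M *v x) \<le> spec_norm M * norm x" for x
  proof -
    let ?y = "ctranspose M *v x"
    have "norm ?y * norm ?y = (M *v ?y) \<bullet> x"
      by (simp add: inner_ctranspose power2_norm_eq_inner flip: power2_eq_square)
    also have "\<dots> \<le> norm (M *v ?y) * norm x"
      by (rule norm_cauchy_schwarz)
    also have "\<dots> \<le> spec_norm M * norm ?y * norm x"
      by (intro mult_right_mono norm_mult_vec_le) auto
    finally have "norm ?y * norm ?y \<le> norm ?y * (spec_norm M * norm x)"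
      by (simp add: mult_ac)
    then show ?thesis
      by (cases "norm ?y = 0") (auto simp: spec_norm_nonneg mult_le_cancel_left)
  qed
  then show ?thesis
    unfolding spec_norm_def[of "ctranspose M"] by (rule onorm_le)
qed

lemma frob_norm_square_columns: "(frob_norm M)\<^sup>2 = (\<Sum>j\<in>UNIV. (norm (column j M))\<^sup>2)"
proof -
  have "(frob_norm M)\<^sup>2 = (\<Sum>i\<in>UNIV. \<Sum>j\<in>UNIV. (cmod (M $ i $ j))\<^sup>2)"
    by (simp add: frob_norm_def sum_nonneg)
  also have "\<dots> = (\<Sum>j\<in>UNIV. \<Sum>i\<in>UNIV. (cmod (M $ i $ j))\<^sup>2)"
    by (rule sum.swap)
  finally show ?thesis
    by (simp add: norm_vec_def L2_set_def sum_nonneg column_def)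
qed

lemma frob_norm_mult_le_left:
  "(frob_norm (M ** N))\<^sup>2 \<le> (spec_norm M)\<^sup>2 * (frob_norm N)\<^sup>2"
proof -
  have "column j (M ** N) = M *v column j N" for j
    by (simp add: matrix_vector_mul_assoc flip: mult_axis)
  then have "(norm (column j (M ** N)))\<^sup>2 \<le> (spec_norm M)\<^sup>2 * (norm (column j N))\<^sup>2" for j
    by (simp add: norm_mult_vec_le power_mono flip: power_mult_distrib)
  then show ?thesis
    by (simp add: frob_norm_square_columns sum_distrib_left sum_mono)
qed

text \<open>Passing to adjoints reverses the product and keeps the Frobenius norm, which reduces
  this to the left-hand bound.\<close>

lemma frob_norm_mult_le_right:
  "(frob_norm (M ** N))\<^sup>2 \<le> (spec_norm N)\<^sup>2 * (frob_norm M)\<^sup>2"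
proof -
  have "(frob_norm (M ** N))\<^sup>2 = (frob_norm (ctranspose N ** ctranspose M))\<^sup>2"
    by (metis ctranspose_mult frob_norm_ctranspose)
  also have "\<dots> \<le> (spec_norm (ctranspose N))\<^sup>2 * (frob_norm M)\<^sup>2"
    using frob_norm_mult_le_left[of "ctranspose N" "ctranspose M"]
    by (simp add: frob_norm_ctranspose)
  also have "\<dots> \<le> (spec_norm N)\<^sup>2 * (frob_norm M)\<^sup>2"
    by (intro mult_right_mono power_mono spec_norm_ctranspose_le spec_norm_nonneg) auto
  finally show ?thesis .
qed

section \<open>Orthogonal projections in the Frobenius norm\<close>

lemma frob_norm_pythagoras:
  assumes "Q ** Q = Q" "ctranspose Q = Q"
  shows "(frob_norm X)\<^sup>2 = (frob_norm (Q ** X))\<^sup>2 + (frob_norm (X - Q ** X))\<^sup>2"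
proof -
  have "ctranspose (Q ** X) ** (Q ** X) = ctranspose X ** Q ** X"
    using assms by (metis ctranspose_mult matrix_mul_assoc)
  moreover have "ctranspose X ** Q ** (Q ** X) = ctranspose X ** Q ** X"
    using assms by (metis matrix_mul_assoc)
  ultimately show ?thesis
    by (simp add: frob_norm_square_trace ctranspose_diff ctranspose_mult assms(2)
        matrix_diff_ldistrib matrix_diff_rdistrib trace_sub matrix_mul_assoc)
qed

text \<open>The Gram matrix of \<open>P - Q ** P\<close> collapses to
  \<open>P - P ** Q ** P\<close>, and the trace is cyclic. Exchanging \<open>P\<close> and
  \<open>Q\<close> changes only the first trace on the right.\<close>

lemma frob_norm_proj_complement:
  assumes "P ** P = P" "ctranspose P = P" "Q ** Q = Q" "ctranspose Q = Q"
  shows "(frob_norm (P - Q ** P))\<^sup>2 = Re (trace P) - Re (trace (P ** Q))"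
proof -
  have "P ** Q ** (Q ** P) = P ** Q ** P"
    using assms by (metis matrix_mul_assoc)
  moreover have "trace (P ** Q ** P) = trace (P ** Q)"
    using assms by (metis matrix_mul_assoc trace_mul_sym)
  ultimately show ?thesis
    by (simp add: frob_norm_square_trace ctranspose_diff ctranspose_mult assms
        matrix_diff_ldistrib matrix_diff_rdistrib trace_sub matrix_mul_assoc)
qed

lemma frob_norm_proj_diff:
  assumes "P ** P = P" "ctranspose P = P" "Q ** Q = Q" "ctranspose Q = Q"
  shows "(frob_norm (Q - P))\<^sup>2 = (frob_norm (P - Q ** P))\<^sup>2 + (frob_norm (Q - P ** Q))\<^sup>2"
  unfolding frob_norm_proj_complement[OF assms]
    frob_norm_proj_complement[OF assms(3,4) assms(1,2)]
  using trace_mul_sym[of P Q]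
  by (simp add: frob_norm_square_trace ctranspose_diff assms
      matrix_diff_ldistrib matrix_diff_rdistrib trace_sub)

lemma col_proj_idem: "col_proj M ** col_proj M = col_proj M"
  and col_proj_hermitian: "ctranspose (col_proj M) = col_proj M"
  and col_proj_absorb: "col_proj M ** M = M"
  using pinv_moore_penrose[of M]
  unfolding col_proj_def is_moore_penrose_def by (simp_all add: matrix_mul_assoc)

lemma perturbation_bound:
  "(frob_norm ((B - A) ** pinv A))\<^sup>2 - alpha1 A B
    \<le> (frob_norm (col_proj A - col_proj B ** col_proj A))\<^sup>2"
proof -
  let ?X = "(B - A) ** pinv A"
  \<comment> \<open>\<open>?X\<close> is \<open>B ** pinv A - col_proj A\<close>, whose first term
    is fixed by \<open>col_proj B\<close> and so cancels.\<close>
  have QX: "?X - col_proj B ** ?X = - (col_proj A - col_proj B ** col_proj A)"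
    by (simp add: matrix_diff_ldistrib matrix_diff_rdistrib matrix_mul_assoc col_proj_absorb)
       (simp add: col_proj_def matrix_mul_assoc)
  have *: "(frob_norm ?X)\<^sup>2 = (frob_norm (col_proj B ** ?X))\<^sup>2
      + (frob_norm (col_proj A - col_proj B ** col_proj A))\<^sup>2"
    using frob_norm_pythagoras[OF col_proj_idem[of B] col_proj_hermitian, of ?X]
    unfolding QX frob_norm_eq_norm norm_minus_cancel .
  \<comment> \<open>Two factorizations of the same matrix, one for each argument of the minimum in
    \<open>alpha1\<close>.\<close>
  have 1: "col_proj B ** ?X = B ** (pinv B ** (B - A) ** pinv A)"
    by (simp add: col_proj_def matrix_mul_assoc)
  have "pinv A ** A ** pinv A = pinv A"
    using pinv_moore_penrose[of A] by (simp add: is_moore_penrose_def)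
  then have "B ** pinv A ** A ** pinv A = B ** pinv A"
    by (metis matrix_mul_assoc)
  then have 2: "col_proj B ** ?X = - (B ** (pinv B - pinv A) ** A ** pinv A)"
    by (simp add: matrix_diff_ldistrib matrix_diff_rdistrib matrix_mul_assoc col_proj_absorb)
       (simp add: col_proj_def matrix_mul_assoc)
  have "(frob_norm (col_proj B ** ?X))\<^sup>2
      \<le> (spec_norm B)\<^sup>2 * (frob_norm (pinv B ** (B - A) ** pinv A))\<^sup>2"
    unfolding 1 by (rule frob_norm_mult_le_left)
  moreover have "(frob_norm (col_proj B ** ?X))\<^sup>2
      \<le> (spec_norm (pinv A))\<^sup>2 * (frob_norm (B ** (pinv B - pinv A) ** A))\<^sup>2"
    using frob_norm_mult_le_right[of "B ** (pinv B - pinv A) ** A" "pinv A"]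
    unfolding 2 by (simp add: frob_norm_eq_norm)
  ultimately show ?thesis
    unfolding * alpha1_def by simp
qed

lemma frob_norm_mult_diff_commute:
  "frob_norm (X ** (M - N) ** Y) = frob_norm (X ** (N - M) ** Y)"
  by (simp add: matrix_diff_ldistrib matrix_diff_rdistrib frob_norm_eq_norm norm_minus_commute)

lemma alpha2_eq_alpha1_swap: "alpha2 A B = alpha1 B A"
  unfolding alpha1_def alpha2_def frob_norm_mult_diff_commute[of _ B A]
    frob_norm_mult_diff_commute[of _ "pinv B" "pinv A"] ..

section \<open>Equal rank gives equal trace\<close>

text \<open>An isomorphism \<open>f\<close> of the two ranges with inverse \<open>g\<close> yields
  matrices \<open>S\<close>, \<open>T\<close> such that \<open>P\<close> and \<open>Q\<close> are
  the two products of \<open>T ** Q\<close> and \<open>S ** P\<close>; cyclicity of the trace does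
  the rest.\<close>

lemma trace_idempotent_eq:
  fixes P Q :: "'a::field^'n^'n"
  assumes P: "P ** P = P" and Q: "Q ** Q = Q"
    and dim: "vec.dim (range ((*v) P)) = vec.dim (range ((*v) Q))"
  shows "trace P = trace Q"
proof -
  have sub: "vec.subspace (range ((*v) M))" for M :: "'a^'n^'n"
    by (intro vec.linear_subspace_image matrix_vector_mul_linear_gen vec.subspace_UNIV)
  obtain f where f: "Vector_Spaces.linear (*s) (*s) f"
      "f ` range ((*v) P) = range ((*v) Q)" "inj_on f (range ((*v) P))"
    using vec.subspace_isomorphism[OF sub sub dim] by blast
  obtain g where g: "range g \<subseteq> range ((*v) P)" "Vector_Spaces.linear (*s) (*s) g"
      "\<And>v. v \<in> range ((*v) P) \<Longrightarrow> g (f v) = v"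
    using vec.linear_exists_left_inverse_on[OF f(1) sub f(3)] by blast
  define S where "S = matrix f"
  define T where "T = matrix g"
  have S: "S *v x = f x" and T: "T *v x = g x" for x
    unfolding S_def T_def using f g by (simp_all add: matrix_works)
  have fix_P: "P *v x = x" if "x \<in> range ((*v) P)" for x
    using that P by (auto simp: matrix_vector_mul_assoc)
  have fix_Q: "Q *v x = x" if "x \<in> range ((*v) Q)" for x
    using that Q by (auto simp: matrix_vector_mul_assoc)
  have fg: "f (g y) = y" if "y \<in> range ((*v) Q)" for y
    using that f(2) g(3) by (metis imageE)
  have "trace P = trace (T ** (Q ** (S ** P)))"
  proof -
    have "g (Q *v f (P *v x)) = P *v x" for x
      using f(2) g(3) fix_Q by (metis imageI rangeI)
    then have "T ** (Q ** (S ** P)) = P"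
      by (simp add: matrix_eq S T flip: matrix_vector_mul_assoc)
    then show ?thesis by simp
  qed
  also have "\<dots> = trace (S ** (P ** (T ** Q)))"
    using trace_mul_sym[of "T ** Q" "S ** P"] by (simp add: matrix_mul_assoc)
  also have "S ** (P ** (T ** Q)) = Q"
  proof -
    have "f (P *v g (Q *v x)) = Q *v x" for x
      using g(1) fg fix_P by (metis rangeI subsetD)
    then show ?thesis
      by (simp add: matrix_eq S T flip: matrix_vector_mul_assoc)
  qed
  finally show ?thesis .
qed

lemma rank_eq_dim_range_transpose:
  fixes A :: "'a::field^'n^'m"
  shows "rank A = vec.dim (range ((*v) (transpose A)))"
proof -
  have "range ((*v) (transpose A)) = vec.span (rows A)"
  proof
    \<comment> \<open>The range of the transpose consists of the linear combinations of rows, so it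
      is the row space.\<close>
    have eq: "transpose A *v x = (\<Sum>i\<in>UNIV. x $ i *s row i A)" for x
      by (simp add: matrix_mult_sum)
    show "range ((*v) (transpose A)) \<subseteq> vec.span (rows A)"
      unfolding eq by (intro image_subsetI vec.span_sum vec.span_scale vec.span_base)
        (auto simp: rows_def)
    have "row i A = transpose A *v axis i 1" for i
      by (simp add: vec_eq_iff matrix_vector_mult_def axis_def row_def transpose_def
          if_distrib cong: if_cong)
    then have "rows A \<subseteq> range ((*v) (transpose A))"
      by (auto simp: rows_def)
    then show "vec.span (rows A) \<subseteq> range ((*v) (transpose A))"
      by (intro vec.span_minimal vec.linear_subspace_image matrix_vector_mul_linear_gen
          vec.subspace_UNIV)
  qed
  then show ?thesis
    by (simp add: row_rank_def_gen vec.dim_span)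
qed

lemma trace_transpose: "trace (transpose M) = trace M"
  by (simp add: trace_def transpose_def)

text \<open>The library defines \<open>rank\<close> by rows, hence the detour through the projection
  \<open>A\<^sup>\<dagger> A\<close> onto the row space, which has the same trace.\<close>

lemma trace_col_proj_eq:
  fixes A B :: "complex^'n^'m"
  assumes "rank A = rank B"
  shows "trace (col_proj A) = trace (col_proj B)"
proof -
  \<comment> \<open>The transpose without conjugation makes \<open>R M\<close> an idempotent with
    the range of \<open>transpose M\<close>, whose dimension is \<open>rank M\<close>.\<close>
  define R :: "complex^'n^'m \<Rightarrow> complex^'n^'n" where "R M = transpose (pinv M ** M)" for M
  have tr: "trace (R M) = trace (col_proj M)" for M
    unfolding R_def col_proj_def trace_transpose by (rule trace_mul_sym)
  have mp: "M ** pinv M ** M = M" for M :: "complex^'n^'m"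
    using pinv_moore_penrose[of M] by (simp add: is_moore_penrose_def)
  have idem: "R M ** R M = R M" for M
    unfolding R_def by (metis mp matrix_mul_assoc matrix_transpose_mul)
  have range: "range ((*v) (R M)) = range ((*v) (transpose M))" for M
  proof
    have "R M = transpose M ** transpose (pinv M)"
      by (simp add: R_def matrix_transpose_mul)
    then show "range ((*v) (R M)) \<subseteq> range ((*v) (transpose M))"
      by (auto simp flip: matrix_vector_mul_assoc)
    have "transpose M = R M ** transpose M"
      unfolding R_def by (metis mp matrix_mul_assoc matrix_transpose_mul)
    then show "range ((*v) (transpose M)) \<subseteq> range ((*v) (R M))"
      by (metis image_subsetI matrix_vector_mul_assoc rangeI)
  qed
  show ?thesis
    using trace_idempotent_eq[OF idem idem, of A B] assms
    by (simp add: range tr rank_eq_dim_range_transpose)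
qed

theorem theorem3p4:
  fixes A B :: "complex^'n^'m" and r s :: nat
  assumes "rank A = r" and "r \<ge> 1"
    and "rank B = s" and "s \<ge> 1"
  defines "E \<equiv> B - A"
  shows "(frob_norm (col_proj B - col_proj A))\<^sup>2 \<ge>
           (frob_norm (E ** pinv A))\<^sup>2 + (frob_norm (E ** pinv B))\<^sup>2 - alpha1 A B - alpha2 A B \<and>
         (s = r \<longrightarrow>
           (frob_norm (col_proj B - col_proj A))\<^sup>2 \<ge>
             2 * max ((frob_norm (E ** pinv A))\<^sup>2 - alpha1 A B)
                     ((frob_norm (E ** pinv B))\<^sup>2 - alpha2 A B))"
proof -
  let ?P = "col_proj A" and ?Q = "col_proj B"
  note proj = col_proj_idem col_proj_hermitian
  have split: "(frob_norm (?Q - ?P))\<^sup>2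
      = (frob_norm (?P - ?Q ** ?P))\<^sup>2 + (frob_norm (?Q - ?P ** ?Q))\<^sup>2"
    by (intro frob_norm_proj_diff proj)
  have 1: "(frob_norm (E ** pinv A))\<^sup>2 - alpha1 A B \<le> (frob_norm (?P - ?Q ** ?P))\<^sup>2"
    unfolding E_def by (rule perturbation_bound)
  \<comment> \<open>Exchanging \<open>A\<close> and \<open>B\<close> only flips the sign of
    \<open>E\<close>, which no norm sees.\<close>
  have "E ** pinv B = - ((A - B) ** pinv B)"
    by (simp add: E_def matrix_diff_rdistrib)
  then have 2: "(frob_norm (E ** pinv B))\<^sup>2 - alpha2 A B \<le> (frob_norm (?Q - ?P ** ?Q))\<^sup>2"
    \<comment> \<open>\<open>B\<close> is the first variable of \<open>perturbation_bound\<close>,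
      so this instance exchanges the two matrices.\<close>
    using perturbation_bound[of A B] by (simp add: alpha2_eq_alpha1_swap frob_norm_eq_norm)
  have "(frob_norm (?P - ?Q ** ?P))\<^sup>2 = (frob_norm (?Q - ?P ** ?Q))\<^sup>2" if "s = r"
    using trace_col_proj_eq[of A B] trace_mul_sym[of ?P ?Q] that assms(1,3)
    by (simp add: frob_norm_proj_complement proj)
  with split 1 2 show ?thesis
    by auto
qed

end
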